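(* Let $Q$ be a bipartite quiver on the vertex set $\{1,\dots,n\}$ with $n \geq 2$ and without parallel arrows, and write its Coxeter polynomial as \[\phi_Q(x) = x^n + a_1 x^{n-1} + a_2 x^{n-2} + \dots .\] Let $e$ be the number of arrows of $Q$, let $d_i$ be the degree of vertex $i$ in the underlying graph of $Q$, and let $q$ be the number of cycles of length $4$ in the underlying graph of $Q$ (equivalently, the number of full subquivers of $Q$ isomorphic to $\widetilde{A}_{2,2}$). Then $a_1 = n - e$ and \[ a_2 = \frac{(n-e)(n-1-e)}{2} + e - 2q - \sum_{i=1}^{n} \binom{d_i}{2}. \]
   Context: A quiver is a directed graph. A quiver on vertex set $\{1,\dots,n\}$ is bipartite if its vertex set can be partitioned as $V' \sqcup V''$ so that every arrow starts in $V'$ and ends in $V''$. Two arrows are parallel if they have the same start and the same end. The adjacency matrix $N_Q$ is the $n\times n$ integer matrix whose $(i,j)$ entry is the number of arrows $i \to j$. For an acyclic quiver (in particular a bipartite one), set $C_Q = I_n - N_Q$; the Coxeter polynomial is $\phi_Q(x) = \det(x C_Q + C_Q^T)$ (equivalently the characteristic polynomial of $-C_Q^{-1}C_Q^T$). The underlying graph is obtained by replacing each arrow by an undirected edge. The quiver $\widetilde{A}_{2,2}$ is the quiver with vertices $u_1,u_2,w_1,w_2$ and arrows $u_i \to w_j$ for all $i,j\in\{1,2\}$. Concretely, if $Q$ has arrows $i\to j$ exactly when $1\le i\le m$ and $j \in B_i\subseteq\{m+1,\dots,n\}$, then $q=\sum_{1\le i<j\le m}\binom{|B_i\cap B_j|}{2}$.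 *)

theory Defs
  imports
    "Graph_Theory.Graph_Theory"
    "Jordan_Normal_Form.Determinant"
begin

text \<open>
  Quivers are the digraphs (with possible loops and parallel arcs) of \<open>Graph_Theory\<close>; the absence
  of parallel arrows is the locale predicate \<open>nomulti_digraph\<close>.  Matrices are indexed from 0
  whereas the vertex set is \<open>{1..n}\<close>, so index \<open>i\<close> stands for vertex \<open>Suc i\<close>.
\<close>

definition bipartite_quiver :: "('a, 'b) pre_digraph \<Rightarrow> bool" where
  "bipartite_quiver Q \<longleftrightarrow> (\<exists>V' V''. verts Q = V' \<union> V'' \<and> V' \<inter> V'' = {} \<and>
     (\<forall>a\<in>arcs Q. tail Q a \<in> V' \<and> head Q a \<in> V''))"

definition adjacency_mat :: "nat \<Rightarrow> (nat, 'b) pre_digraph \<Rightarrow> int mat" where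
  "adjacency_mat n Q =
     mat n n (\<lambda>(i, j). int (card {a \<in> arcs Q. tail Q a = Suc i \<and> head Q a = Suc j}))"

definition cartan_mat :: "nat \<Rightarrow> (nat, 'b) pre_digraph \<Rightarrow> int mat" where
  "cartan_mat n Q = 1\<^sub>m n - adjacency_mat n Q"

definition coxeter_poly :: "nat \<Rightarrow> (nat, 'b) pre_digraph \<Rightarrow> int poly" where
  "coxeter_poly n Q =
     det ([:0, 1:] \<cdot>\<^sub>m map_mat (\<lambda>c. [:c:]) (cartan_mat n Q)
          + map_mat (\<lambda>c. [:c:]) (transpose_mat (cartan_mat n Q)))"

text \<open>
  The underlying graph of \<open>Q\<close> is the undirected multigraph with vertex set \<open>verts Q\<close>, edge set
  \<open>arcs Q\<close>, and incidence function \<open>edge_ends Q\<close>.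
\<close>

definition edge_ends :: "('a, 'b) pre_digraph \<Rightarrow> 'b \<Rightarrow> 'a set" where
  "edge_ends Q a = {tail Q a, head Q a}"

text \<open>As usual, a loop contributes 2 to the degree; the second summand accounts for this.\<close>

definition underlying_degree :: "('a, 'b) pre_digraph \<Rightarrow> 'a \<Rightarrow> nat" where
  "underlying_degree Q v =
     card {a \<in> arcs Q. v \<in> edge_ends Q a} + card {a \<in> arcs Q. edge_ends Q a = {v}}"

text \<open>
  A cycle is identified with its set of edges, so that starting point and sense of traversal do
  not matter for counting.
\<close>

definition underlying_cycles :: "('a, 'b) pre_digraph \<Rightarrow> nat \<Rightarrow> 'b set set" where
  "underlying_cycles Q k = {set es | es vs.
     1 \<le> k \<and> length es = k \<and> length vs = k \<and> distinct es \<and> distinct vs \<and> set es \<subseteq> arcs Q \<and>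
     (\<forall>i<k. edge_ends Q (es ! i) = {vs ! i, vs ! (Suc i mod k)})}"

text \<open>The vertex \<open>u\<^sub>i\<close> is \<open>Inl i\<close> and the vertex \<open>w\<^sub>j\<close> is \<open>Inr j\<close>.\<close>

definition A22_tilde :: "(nat + nat, (nat + nat) \<times> (nat + nat)) pre_digraph" where
  "A22_tilde = \<lparr> verts = {1, 2} <+> {1, 2},
     arcs = {(Inl i, Inr j) | i j. i \<in> {1, 2} \<and> j \<in> {1, 2}}, tail = fst, head = snd \<rparr>"

text \<open>
  A full subquiver is an induced subgraph.  Subgraphs carry the tail and head functions of
  \<open>Q\<close> itself, so distinct records here are distinct subquivers.
\<close>

definition full_A22_subquivers :: "('a, 'b) pre_digraph \<Rightarrow> ('a, 'b) pre_digraph set" where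
  "full_A22_subquivers Q = {H. induced_subgraph H Q \<and> digraph_iso H A22_tilde}"

end

theory Submission
  imports Defs "Jordan_Normal_Form.Schur_Decomposition"
begin

text \<open>
  Write \<open>N\<close> for the adjacency matrix and \<open>C = I - N\<close>.  Bipartiteness gives \<open>N\<^sup>2 = 0\<close>, so
  \<open>C\<close> has inverse \<open>I + N\<close> and determinant 1, and the Coxeter polynomial is the characteristic
  polynomial of \<open>B = (I + N) (N\<^sup>T - I)\<close>.  Its first two nontrivial coefficients are \<open>- tr B\<close> and
  \<open>((tr B)\<^sup>2 - tr B\<^sup>2) / 2\<close>.  The traces reduce to \<open>e\<close> and \<open>tr (N N\<^sup>T)\<^sup>2\<close>; the latter counts closed
  walks of length 4, among them four for every 4-cycle.  Both 4-cycles and full subquivers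
  isomorphic to \<open>A22_tilde\<close> correspond to pairs \<open>(U, W)\<close> of 2-sets with all arrows from \<open>U\<close> to \<open>W\<close> present.
\<close>

section \<open>Traces and the Coxeter polynomial\<close>

definition trace_mat :: "'a :: comm_monoid_add mat \<Rightarrow> 'a" where
  "trace_mat A = (\<Sum>i<dim_row A. A $$ (i, i))"

lemma trace_mult:
  assumes "A \<in> carrier_mat n m" "B \<in> carrier_mat m n"
  shows "trace_mat (A * B) = (\<Sum>i<n. \<Sum>j<m. A $$ (i, j) * B $$ (j, i))"
  using assms by (auto simp: trace_mat_def scalar_prod_def lessThan_atLeast0 intro!: sum.cong)

lemma trace_comm:
  fixes A B :: "'a :: comm_semiring_0 mat"
  assumes "A \<in> carrier_mat n m" "B \<in> carrier_mat m n"
  shows "trace_mat (A * B) = trace_mat (B * A)"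
  unfolding trace_mult[OF assms] trace_mult[OF assms(2,1)]
  by (subst sum.swap) (simp add: mult.commute)

text \<open>Cyclicity of the trace moves \<open>Q\<close> to the front, where \<open>Q * P\<close>
  cancels.\<close>

lemma trace_similar:
  fixes A B :: "'a :: comm_ring_1 mat"
  assumes "similar_mat A B"
  shows "trace_mat A = trace_mat B"
proof -
  from similar_matD[OF assms] obtain n P Q where
    carr: "A \<in> carrier_mat n n" "B \<in> carrier_mat n n" "P \<in> carrier_mat n n" "Q \<in> carrier_mat n n"
    and eqs: "Q * P = 1\<^sub>m n" "A = P * B * Q" by auto
  have "trace_mat A = trace_mat (Q * (P * B))"
    unfolding eqs(2) by (rule trace_comm[of _ n n]) (use carr in auto)
  also have "Q * (P * B) = B"
    using carr eqs(1) by (simp add: assoc_mult_mat[of Q n n P n B n, symmetric])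
  finally show ?thesis .
qed

text \<open>The inner factor \<open>Q * P\<close> of the squared product cancels. This carries the
  trace of a square over to a triangular form.\<close>

lemma similar_mat_square:
  assumes "similar_mat A B"
  shows "similar_mat (A * A) (B * B)"
proof -
  from similar_matD[OF assms] obtain n P Q where
    carr: "A \<in> carrier_mat n n" "B \<in> carrier_mat n n" "P \<in> carrier_mat n n" "Q \<in> carrier_mat n n"
    and eqs: "P * Q = 1\<^sub>m n" "Q * P = 1\<^sub>m n" "A = P * B * Q" by auto
  have "A * A = P * B * (Q * (P * (B * Q)))"
    using carr unfolding eqs(3) by (simp add: assoc_mult_mat[of _ n n _ n _ n])
  also have "Q * (P * (B * Q)) = B * Q"
    using carr eqs(2) by (simp add: assoc_mult_mat[of Q n n P n "B * Q" n, symmetric])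
  also have "P * B * (B * Q) = P * (B * B) * Q"
    using carr by (simp add: assoc_mult_mat[of _ n n _ n _ n])
  finally show ?thesis using carr eqs
    unfolding similar_mat_def by (intro exI[of _ P] exI[of _ Q] similar_mat_witI[of _ _ n]) auto
qed

section \<open>The two coefficients below the leading one of a characteristic polynomial\<close>

text \<open>The vanishing above the length is part of the induction: the leading coefficient of the
  longer product contains \<open>- a\<close> times a coefficient of the shorter one beyond its
  length.\<close>

lemma prod_linear_coeff_length:
  fixes as :: "'a :: comm_ring_1 list"
  shows "coeff (\<Prod>a\<leftarrow>as. [:- a, 1:]) (length as) = 1
    \<and> (\<forall>k > length as. coeff (\<Prod>a\<leftarrow>as. [:- a, 1:]) k = 0)"
  by (induction as) (auto simp: coeff_pCons split: nat.splits)

lemma prod_linear_coeff_1: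
  fixes as :: "'a :: comm_ring_1 list"
  assumes "length as = Suc k"
  shows "coeff (\<Prod>a\<leftarrow>as. [:- a, 1:]) k = - sum_list as"
  using assms
proof (induction as arbitrary: k)
  case (Cons a as)
  show ?case
  proof (cases k)
    case 0
    then show ?thesis using Cons.prems by simp
  next
    case (Suc j)
    then show ?thesis
      using Cons prod_linear_coeff_length[of as] by (simp add: coeff_pCons)
  qed
qed simp

text \<open>Newton's identity for the second elementary symmetric function of the roots, kept
  doubled so that the ring needs no division. The induction step meets the coefficient next to the
  leading one, supplied by \<open>prod_linear_coeff_1\<close>.\<close>

lemma prod_linear_coeff_2:
  fixes as :: "'a :: comm_ring_1 list"
  assumes "length as = Suc (Suc k)"
  shows "2 * coeff (\<Prod>a\<leftarrow>as. [:- a, 1:]) k = (sum_list as)\<^sup>2 - (\<Sum>a\<leftarrow>as. a\<^sup>2)"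
  using assms
proof (induction as arbitrary: k)
  case (Cons a as)
  have c1: "coeff (\<Prod>a\<leftarrow>as. [:- a, 1:]) k = - sum_list as"
    using Cons.prems by (intro prod_linear_coeff_1) simp
  show ?case
  proof (cases k)
    \<comment> \<open>At index 0 there is no lower coefficient to recurse on; the list then has
      exactly two entries.\<close>
    case 0
    with Cons.prems obtain b where "as = [b]"
      by (auto simp: length_Suc_conv)
    with 0 show ?thesis by (simp add: power2_eq_square algebra_simps)
  next
    case (Suc j)
    have "2 * coeff (\<Prod>a\<leftarrow>as. [:- a, 1:]) j = (sum_list as)\<^sup>2 - (\<Sum>a\<leftarrow>as. a\<^sup>2)"
      using Cons Suc by simp
    then show ?thesis
      using c1 Suc by (simp add: coeff_pCons algebra_simps power2_eq_square)
  qed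
qed simp

lemma trace_eq_sum_list_diag: "trace_mat A = sum_list (diag_mat A)"
  by (simp add: trace_mat_def diag_mat_def interv_sum_list_conv_sum_set_nat lessThan_atLeast0)

text \<open>For distinct \<open>i\<close> and \<open>j\<close> one of the positions
  \<open>(i, j)\<close> and \<open>(j, i)\<close> lies below the diagonal, so only diagonal products
  survive.\<close>

lemma trace_square_upper_triangular:
  fixes B :: "'a :: comm_semiring_1 mat"
  assumes "B \<in> carrier_mat n n" "upper_triangular B"
  shows "trace_mat (B * B) = (\<Sum>b\<leftarrow>diag_mat B. b\<^sup>2)"
proof -
  have "B $$ (i, j) * B $$ (j, i) = (if j = i then (B $$ (i, i))\<^sup>2 else 0)"
    if "i < n" "j < n" for i j
    using upper_triangularD[OF assms(2), of i j] upper_triangularD[OF assms(2), of j i] that assms(1)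
    by (cases i j rule: linorder_cases) (auto simp: power2_eq_square)
  then have "trace_mat (B * B) = (\<Sum>i<n. \<Sum>j<n. if j = i then (B $$ (i, i))\<^sup>2 else 0)"
    unfolding trace_mult[OF assms(1,1)] by (intro sum.cong) auto
  also have "\<dots> = (\<Sum>i<n. (B $$ (i, i))\<^sup>2)"
    by (simp add: sum.delta)
  finally show ?thesis using assms(1)
    by (simp add: diag_mat_def comp_def interv_sum_list_conv_sum_set_nat lessThan_atLeast0)
qed

text \<open>Schur triangularisation: the diagonal of \<open>B\<close> lists the roots of the
  characteristic polynomial, and the traces of \<open>A\<close> and \<open>A * A\<close> become
  power sums of these roots.\<close>

lemma char_poly_coeffs_complex:
  fixes A :: "complex mat"
  assumes A: "A \<in> carrier_mat n n" and n: "n \<ge> 2"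
  shows "coeff (char_poly A) (n - 1) = - trace_mat A"
    and "2 * coeff (char_poly A) (n - 2) = (trace_mat A)\<^sup>2 - trace_mat (A * A)"
proof -
  obtain B where B: "B \<in> carrier_mat n n" "upper_triangular B" "similar_mat A B"
    using schur_decomposition_exists[OF A] char_poly_factorized[OF A] by blast
  have p: "char_poly A = (\<Prod>a\<leftarrow>diag_mat B. [:- a, 1:])"
    using char_poly_similar[OF B(3)] char_poly_upper_triangular[OF B(1,2)] by simp
  have len: "length (diag_mat B) = n"
    using B(1) by (simp add: diag_mat_def)
  have trA: "trace_mat A = sum_list (diag_mat B)"
    using trace_similar[OF B(3)] by (simp add: trace_eq_sum_list_diag)
  have trAA: "trace_mat (A * A) = (\<Sum>b\<leftarrow>diag_mat B. b\<^sup>2)"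
    using trace_similar[OF similar_mat_square[OF B(3)]] trace_square_upper_triangular[OF B(1,2)]
    by simp
  show "coeff (char_poly A) (n - 1) = - trace_mat A"
    unfolding p trA using len n by (intro prod_linear_coeff_1) simp
  show "2 * coeff (char_poly A) (n - 2) = (trace_mat A)\<^sup>2 - trace_mat (A * A)"
    unfolding p trA trAA using len n by (intro prod_linear_coeff_2) simp
qed

text \<open>Transfer along the embedding of the integers into the complex numbers, which commutes
  with characteristic polynomials, products and traces; its injectivity brings the identities
  back.\<close>

lemma char_poly_coeffs_int:
  fixes A :: "int mat"
  assumes A: "A \<in> carrier_mat n n" and n: "n \<ge> 2"
  shows "coeff (char_poly A) (n - 1) = - trace_mat A"
    and "2 * coeff (char_poly A) (n - 2) = (trace_mat A)\<^sup>2 - trace_mat (A * A)"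
proof -
  let ?h = "of_int :: int \<Rightarrow> complex"
  let ?A = "map_mat ?h A"
  have A': "?A \<in> carrier_mat n n" using A by simp
  have tr: "trace_mat (map_mat ?h X) = ?h (trace_mat X)" if "X \<in> carrier_mat n n" for X
    using that by (simp add: trace_mat_def)
  have sq: "?A * ?A = map_mat ?h (A * A)"
    by (rule of_int_hom.mat_hom_mult[OF A A, symmetric])
  have "?h (coeff (char_poly A) (n - 1)) = ?h (- trace_mat A)"
    using char_poly_coeffs_complex(1)[OF A' n] tr[OF A] of_int_hom.char_poly_hom[OF A, where ?'a = complex]
    by simp
  then show "coeff (char_poly A) (n - 1) = - trace_mat A"
    by (simp only: of_int_eq_iff)
  have "?h (2 * coeff (char_poly A) (n - 2)) = ?h ((trace_mat A)\<^sup>2 - trace_mat (A * A))"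
    using char_poly_coeffs_complex(2)[OF A' n] tr[OF A] tr[of "A * A"] A sq
      of_int_hom.char_poly_hom[OF A, where ?'a = complex]
    by simp
  then show "2 * coeff (char_poly A) (n - 2) = (trace_mat A)\<^sup>2 - trace_mat (A * A)"
    by (simp only: of_int_eq_iff)
qed

section \<open>From the Coxeter polynomial to a characteristic polynomial\<close>

text \<open>In the Leibniz expansion only the identity contributes. A permutation that moves
  \<open>i\<close> also moves \<open>p i\<close>, so its product contains, up to sign, the entries
  of \<open>N\<close> at \<open>(i, p i)\<close> and \<open>(p i, p (p i))\<close>, one of which is
  zero by \<open>bip\<close>.\<close>

lemma det_one_minus_bipartite:
  fixes N :: "'a :: comm_ring_1 mat"
  assumes N: "N \<in> carrier_mat n n"
    and bip: "\<And>i j k. i < n \<Longrightarrow> j < n \<Longrightarrow> k < n \<Longrightarrow> N $$ (i, j) = 0 \<or> N $$ (j, k) = 0"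
  shows "det (1\<^sub>m n - N) = 1"
proof -
  let ?C = "1\<^sub>m n - N"
  have C: "?C \<in> carrier_mat n n" using N by (rule minus_carrier_mat)
  have diag: "N $$ (i, i) = 0" if "i < n" for i using bip[of i i i] that by simp
  have "(\<Prod>i = 0..<n. ?C $$ (i, p i)) = (if p = id then 1 else 0)" if p: "p permutes {0..<n}" for p
  proof (cases "p = id")
    case True
    then show ?thesis using diag N by simp
  next
    case False
    then obtain i where i: "p i \<noteq> i" by (auto simp: fun_eq_iff)
    then have lt: "i < n" using permutes_not_in[OF p, of i] by auto
    then have lt': "p i < n" "p (p i) < n" using permutes_in_image[OF p] by auto
    have ne: "p (p i) \<noteq> p i" using i permutes_inj[OF p] by (auto dest: injD)
    from bip[OF lt lt'] have "?C $$ (i, p i) = 0 \<or> ?C $$ (p i, p (p i)) = 0"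
      using N lt lt' i ne by auto
    then have "\<exists>j\<in>{0..<n}. ?C $$ (j, p j) = 0" using lt lt' by auto
    then show ?thesis using False prod_zero[of "{0..<n}" "\<lambda>j. ?C $$ (j, p j)"] by simp
  qed
  then have "det ?C = (\<Sum>p | p permutes {0..<n}. signof p * (if p = id then 1 else 0))"
    unfolding det_def'[OF C] by (intro sum.cong) auto
  also have "\<dots> = (\<Sum>p | p permutes {0..<n}. if p = id then 1 else 0)"
    by (intro sum.cong) auto
  also have "\<dots> = 1"
    by (subst sum.delta) (auto simp: finite_permutations permutes_id)
  finally show ?thesis .
qed

text \<open>Since \<open>?C * ?M\<close> is the identity and \<open>?D\<close> is minus the
  transpose of \<open>?C\<close>, left multiplication by \<open>?C\<close> turns the characteristic
  matrix of \<open>?M * ?D\<close> into the matrix of the Coxeter polynomial. The factor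
  \<open>?C\<close> has determinant 1.\<close>

lemma det_coxeter_eq_char_poly:
  fixes N :: "'a :: comm_ring_1 mat"
  assumes N: "N \<in> carrier_mat n n"
    and bip: "\<And>i j k. i < n \<Longrightarrow> j < n \<Longrightarrow> k < n \<Longrightarrow> N $$ (i, j) = 0 \<or> N $$ (j, k) = 0"
  shows "det ([:0, 1:] \<cdot>\<^sub>m map_mat (\<lambda>c. [:c:]) (1\<^sub>m n - N)
          + map_mat (\<lambda>c. [:c:]) (transpose_mat (1\<^sub>m n - N)))
    = char_poly ((1\<^sub>m n + N) * (transpose_mat N - 1\<^sub>m n))"
proof -
  let ?C = "1\<^sub>m n - N" and ?M = "1\<^sub>m n + N" and ?D = "transpose_mat N - 1\<^sub>m n"
  let ?c = "map_mat (\<lambda>c::'a. [:c:])"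
  have carr: "?C \<in> carrier_mat n n" "?M \<in> carrier_mat n n" "?D \<in> carrier_mat n n"
    "?M * ?D \<in> carrier_mat n n" using N by auto
  \<comment> \<open>There are no paths of length 2, so the geometric series inverting
    \<open>?C\<close> stops after the term \<open>N\<close>.\<close>
  have NN: "N * N = 0\<^sub>m n n"
  proof (rule eq_matI)
    fix i k assume "i < dim_row (0\<^sub>m n n)" "k < dim_col (0\<^sub>m n n)"
    then have ik: "i < n" "k < n" by auto
    have "N $$ (i, j) * N $$ (j, k) = 0" if "j < n" for j
      using bip[OF ik(1) that ik(2)] by auto
    then show "(N * N) $$ (i, k) = 0\<^sub>m n n $$ (i, k)"
      using ik N by (simp add: scalar_prod_def)
  qed (use N in auto)
  have "?C * ?M = ?C * 1\<^sub>m n + ?C * N"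
    using N by (intro mult_add_distrib_mat) auto
  also have "?C * N = 1\<^sub>m n * N - N * N"
    using N by (intro minus_mult_distrib_mat) auto
  also have "?C * 1\<^sub>m n = ?C" using N by simp
  also have "?C + (1\<^sub>m n * N - N * N) = 1\<^sub>m n"
    unfolding NN using N by (intro eq_matI) auto
  finally have "?C * (?M * ?D) = ?D"
    using carr by (simp add: assoc_mult_mat[of ?C n n ?M n ?D n, symmetric])
  then have CB: "?c ?C * ?c (?M * ?D) = ?c ?D"
    using map_poly_mult(1)[OF carr(1,4)] by simp
  have cp: "char_poly_matrix (?M * ?D) = [:0, 1:] \<cdot>\<^sub>m 1\<^sub>m n - ?c (?M * ?D)"
    unfolding char_poly_matrix_def using carr(2,3) by (intro eq_matI) auto
  have "?c ?C * char_poly_matrix (?M * ?D) = ?c ?C * ([:0, 1:] \<cdot>\<^sub>m 1\<^sub>m n) - ?c ?D"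
    unfolding cp using carr CB by (subst mult_minus_distrib_mat[of _ n n]) auto
  also have "?c ?C * ([:0, 1:] \<cdot>\<^sub>m 1\<^sub>m n) = [:0, 1:] \<cdot>\<^sub>m ?c ?C"
    using carr by (subst mult_smult_distrib[of _ n n]) auto
  also have "[:0, 1:] \<cdot>\<^sub>m ?c ?C - ?c ?D = [:0, 1:] \<cdot>\<^sub>m ?c ?C + ?c (transpose_mat ?C)"
    using N by (intro eq_matI) auto
  finally have "det ([:0, 1:] \<cdot>\<^sub>m ?c ?C + ?c (transpose_mat ?C))
      = det (?c ?C * char_poly_matrix (?M * ?D))" by simp
  also have "\<dots> = det (?c ?C) * char_poly (?M * ?D)"
    unfolding char_poly_def using carr by (intro det_mult[of _ n]) auto
  also have "det (?c ?C) = 1"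
  proof -
    have "?c ?C = 1\<^sub>m n - ?c N"
      using N by (intro eq_matI) (auto simp: one_pCons)
    \<comment> \<open>The determinant lemma is applied over the polynomial ring, to the constant
      lift of \<open>N\<close>.\<close>
    also have "det (1\<^sub>m n - ?c N) = 1"
      using N bip by (intro det_one_minus_bipartite) auto
    finally show ?thesis .
  qed
  finally show ?thesis by simp
qed

text \<open>\<open>B\<close> is the sum of the symmetric matrix
  \<open>N * transpose_mat N - 1\<^sub>m n\<close> and the antisymmetric matrix
  \<open>transpose_mat N - N\<close>, so \<open>B $$ (i, j) * B $$ (j, i)\<close> is a difference of
  two squares. As 0-1 entries equal their squares, the remaining terms sum to multiples of
  \<open>e\<close>.\<close>

lemma trace_coxeter_01:
  fixes N :: "int mat"
  assumes N: "N \<in> carrier_mat n n"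
    and bip: "\<And>i j k. i < n \<Longrightarrow> j < n \<Longrightarrow> k < n \<Longrightarrow> N $$ (i, j) = 0 \<or> N $$ (j, k) = 0"
    and N01: "\<And>i j. i < n \<Longrightarrow> j < n \<Longrightarrow> N $$ (i, j) \<in> {0, 1}"
  defines "B \<equiv> (1\<^sub>m n + N) * (transpose_mat N - 1\<^sub>m n)"
    and "e \<equiv> (\<Sum>i<n. \<Sum>j<n. N $$ (i, j))"
  shows "trace_mat B = e - int n"
    and "trace_mat (B * B) = (\<Sum>i<n. \<Sum>j<n. (\<Sum>k<n. N $$ (i, k) * N $$ (j, k))\<^sup>2) - 4 * e + int n"
proof -
  \<comment> \<open>The entry of \<open>N * transpose_mat N\<close>: the number of common
    out-neighbours of \<open>i\<close> and \<open>j\<close>.\<close>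
  define p where "p i j = (\<Sum>k<n. N $$ (i, k) * N $$ (j, k))" for i j
  define \<delta> where "\<delta> i j = (if i = j then 1 else 0 :: int)" for i j :: nat
  have B: "B \<in> carrier_mat n n" unfolding B_def using N by auto
  have "B = 1\<^sub>m n * (transpose_mat N - 1\<^sub>m n) + N * (transpose_mat N - 1\<^sub>m n)"
    unfolding B_def using N by (intro add_mult_distrib_mat) auto
  also have "N * (transpose_mat N - 1\<^sub>m n) = N * transpose_mat N - N * 1\<^sub>m n"
    using N by (intro mult_minus_distrib_mat) auto
  finally have B_eq: "B = transpose_mat N - 1\<^sub>m n + (N * transpose_mat N - N)"
    using N by simp
  have ent: "B $$ (i, j) = p i j - \<delta> i j + (N $$ (j, i) - N $$ (i, j))" if "i < n" "j < n" for i j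
    unfolding B_eq p_def \<delta>_def using that N
    by (simp add: scalar_prod_def lessThan_atLeast0)
  have sq: "N $$ (i, j) * N $$ (i, j) = N $$ (i, j)" if "i < n" "j < n" for i j
    using N01[OF that] by auto
  have pii: "(\<Sum>i<n. p i i) = e" unfolding p_def e_def by (intro sum.cong) (auto simp: sq)
  have "trace_mat B = (\<Sum>i<n. p i i - 1)"
    using B by (simp add: trace_mat_def ent \<delta>_def)
  then show "trace_mat B = e - int n"
    by (simp add: sum_subtractf pii)
  have psym: "p j i = p i j" for i j unfolding p_def by (simp add: mult.commute)
  have "B $$ (i, j) * B $$ (j, i) =
     (p i j)\<^sup>2 + (if j = i then 1 - 2 * p i i else 0) - N $$ (i, j) - N $$ (j, i)"
    if ij: "i < n" "j < n" for i j
  proof -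
    \<comment> \<open>There are no directed 2-cycles, so the cross term in the square of the
      antisymmetric part vanishes.\<close>
    have 0: "N $$ (i, j) * N $$ (j, i) = 0" using bip[OF ij ij(1)] by auto
    have "B $$ (i, j) * B $$ (j, i) = (p i j - \<delta> i j)\<^sup>2 - (N $$ (j, i) - N $$ (i, j))\<^sup>2"
      unfolding ent[OF ij] ent[OF ij(2,1)] psym[of j i] by (simp add: \<delta>_def power2_eq_square algebra_simps)
    also have "(N $$ (j, i) - N $$ (i, j))\<^sup>2 = N $$ (i, j) + N $$ (j, i)"
      using 0 N01[OF ij] N01[OF ij(2,1)] by auto
    also have "(p i j - \<delta> i j)\<^sup>2 = (p i j)\<^sup>2 + (if j = i then 1 - 2 * p i i else 0)"
      by (simp add: \<delta>_def power2_eq_square algebra_simps)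
    finally show ?thesis by simp
  qed
  then have "trace_mat (B * B) = (\<Sum>i<n. \<Sum>j<n.
      (p i j)\<^sup>2 + (if j = i then 1 - 2 * p i i else 0) - N $$ (i, j) - N $$ (j, i))"
    unfolding trace_mult[OF B B] by (intro sum.cong) auto
  also have "\<dots> = (\<Sum>i<n. \<Sum>j<n. (p i j)\<^sup>2) + (\<Sum>i<n. 1 - 2 * p i i) - e
      - (\<Sum>i<n. \<Sum>j<n. N $$ (j, i))"
    by (simp add: sum.distrib sum_subtractf e_def)
  also have "(\<Sum>i<n. \<Sum>j<n. N $$ (j, i)) = e"
    unfolding e_def by (rule sum.swap)
  also have "(\<Sum>i<n. 1 - 2 * p i i) = int n - 2 * e"
    by (simp add: sum_subtractf pii flip: sum_distrib_left)
  finally show "trace_mat (B * B) =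
      (\<Sum>i<n. \<Sum>j<n. (\<Sum>k<n. N $$ (i, k) * N $$ (j, k))\<^sup>2) - 4 * e + int n"
    by (simp add: p_def)
qed

section \<open>Closed walks of length 4\<close>

definition bicliques22 :: "('a \<times> 'b) set \<Rightarrow> ('a set \<times> 'b set) set" where
  "bicliques22 A = {(U, W). card U = 2 \<and> card W = 2 \<and> U \<times> W \<subseteq> A}"

text \<open>Ordered pairs are grouped by the set they form; every fibre is
  \<open>{(u, v), (v, u)}\<close>.\<close>

lemma sum_symmetric_pairs:
  fixes g :: "'a set \<Rightarrow> 'b :: semiring_1"
  assumes "finite V"
  shows "(\<Sum>i\<in>V. \<Sum>j\<in>V - {i}. g {i, j}) = 2 * (\<Sum>U | U \<subseteq> V \<and> card U = 2. g U)"
proof -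
  let ?P = "SIGMA i:V. V - {i}" and ?S = "{U. U \<subseteq> V \<and> card U = 2}"
  have fin: "finite ?P" "finite ?S" using assms by auto
  have "(\<Sum>i\<in>V. \<Sum>j\<in>V - {i}. g {i, j}) = (\<Sum>x\<in>?P. g {fst x, snd x})"
    using assms by (simp add: sum.Sigma split_def)
  also have "\<dots> = (\<Sum>U\<in>?S. \<Sum>x | x \<in> ?P \<and> {fst x, snd x} = U. g {fst x, snd x})"
    using fin by (intro sum.group[symmetric]) auto
  also have "\<dots> = (\<Sum>U\<in>?S. 2 * g U)"
  proof (intro sum.cong refl)
    fix U assume "U \<in> ?S"
    then obtain u v where uv: "U = {u, v}" "u \<noteq> v" "u \<in> V" "v \<in> V" by (auto simp: card_2_iff)
    then have "{x \<in> ?P. {fst x, snd x} = U} = {(u, v), (v, u)}"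
      by (auto simp: doubleton_eq_iff)
    then show "(\<Sum>x | x \<in> ?P \<and> {fst x, snd x} = U. g {fst x, snd x}) = 2 * g U"
      using uv by (simp add: mult_2 insert_commute)
  qed
  finally show ?thesis by (simp add: sum_distrib_left)
qed

text \<open>For fixed \<open>U\<close> the admissible \<open>W\<close> are the 2-subsets of the
  common out-neighbourhood of \<open>U\<close>. This is the formula for \<open>q\<close> by binomial
  coefficients of the intersections of the sets \<open>B_i\<close>.\<close>

lemma card_bicliques22:
  assumes V: "finite V" and A: "A \<subseteq> V \<times> V"
  shows "card (bicliques22 A) = (\<Sum>U | U \<subseteq> V \<and> card U = 2. card (\<Inter>u\<in>U. A `` {u}) choose 2)"
proof -
  let ?W = "\<lambda>U. {W. W \<subseteq> (\<Inter>u\<in>U. A `` {u}) \<and> card W = 2}"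
  have fin: "finite (\<Inter>u\<in>U. A `` {u})" if U: "card U = 2" for U
  proof -
    obtain u where "u \<in> U" using U by fastforce
    moreover have "finite (A `` {u})" using A V by (auto intro: finite_subset[of _ V])
    ultimately show ?thesis by (meson INF_lower finite_subset)
  qed
  have "bicliques22 A = (SIGMA U:{U. U \<subseteq> V \<and> card U = 2}. ?W U)"
  proof (intro Set.set_eqI iffI)
    fix x assume x: "x \<in> bicliques22 A"
    obtain U W where [simp]: "x = (U, W)" by (cases x)
    have *: "card U = 2" "card W = 2" "U \<times> W \<subseteq> A" using x by (auto simp: bicliques22_def)
    \<comment> \<open>One element of \<open>W\<close> suffices to make every element of
      \<open>U\<close> the start of a pair in \<open>A\<close>, hence a member of
      \<open>V\<close>.\<close>
    then obtain w where "w \<in> W" by fastforce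
    with * A have "U \<subseteq> V" by blast
    with * show "x \<in> (SIGMA U:{U. U \<subseteq> V \<and> card U = 2}. ?W U)" by auto
  qed (auto simp: bicliques22_def)
  then have "card (bicliques22 A) = (\<Sum>U | U \<subseteq> V \<and> card U = 2. card (?W U))"
    using V fin by (subst card_SigmaI[symmetric]) (auto intro: finite_subset[OF _ finite_Pow_iff[THEN iffD2]])
  also have "\<dots> = (\<Sum>U | U \<subseteq> V \<and> card U = 2. card (\<Inter>u\<in>U. A `` {u}) choose 2)"
    using fin by (intro sum.cong refl n_subsets) auto
  finally show ?thesis .
qed

text \<open>Doubled and moved to the integers, so that neither division nor truncated subtraction
  remains.\<close>

lemma two_choose_2: "2 * int (m choose 2) = int m * (int m - 1)"
proof -
  have "even (m * (m - 1))" by (cases m) auto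
  then have "2 * (m choose 2) = m * (m - 1)"
    unfolding choose_two by (rule dvd_mult_div_cancel)
  then have "int (2 * (m choose 2)) = int (m * (m - 1))" by simp
  then show ?thesis by (cases m) (auto simp: algebra_simps)
qed

text \<open>
  Both sides count closed walks of length 4 that start at the left end of an arc: on the right
  those that use one edge, those that use two edges, and those around a 4-cycle.
\<close>

lemma sum_codegree_squares:
  fixes A :: "('a \<times> 'a) set"
  assumes V: "finite V" and A: "A \<subseteq> V \<times> V" and bip: "Domain A \<inter> Range A = {}"
  defines "d \<equiv> \<lambda>v. card (A `` {v}) + card (A\<inverse> `` {v})"
  shows "(\<Sum>i\<in>V. \<Sum>j\<in>V. (int (card (A `` {i} \<inter> A `` {j})))\<^sup>2)
    = int (card A) + 4 * int (card (bicliques22 A)) + 2 * (\<Sum>v\<in>V. int (d v choose 2))"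
proof -
  define p where "p i j = int (card (A `` {i} \<inter> A `` {j}))" for i j
  define outd where "outd v = int (card (A `` {v}))" for v
  define ind where "ind v = int (card (A\<inverse> `` {v}))" for v
  define r where "r i k = (if (i, k) \<in> A then 1 else 0 :: int)" for i k
  have finA: "finite A" using A V by (auto intro: finite_subset)
  have card_r: "int (card {k \<in> V. P k}) = (\<Sum>k\<in>V. if P k then 1 else 0)" for P
    using V by (simp add: sum.If_cases Int_def)
  have p_r: "p i j = (\<Sum>k\<in>V. r i k * r j k)" for i j
  proof -
    have "A `` {i} \<inter> A `` {j} = {k \<in> V. (i, k) \<in> A \<and> (j, k) \<in> A}" using A by auto
    then show ?thesis unfolding p_def by (auto simp: card_r r_def intro!: sum.cong)
  qed
  have out_r: "outd i = (\<Sum>k\<in>V. r i k)" for i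
  proof -
    have "A `` {i} = {k \<in> V. (i, k) \<in> A}" using A by auto
    then show ?thesis unfolding outd_def by (auto simp: card_r r_def intro!: sum.cong)
  qed
  have in_r: "ind k = (\<Sum>i\<in>V. r i k)" for k
  proof -
    have "A\<inverse> `` {k} = {i \<in> V. (i, k) \<in> A}" using A by auto
    then show ?thesis unfolding ind_def by (auto simp: card_r r_def intro!: sum.cong)
  qed
  have pii: "p i i = outd i" for i by (simp add: p_def outd_def)
  have "(SIGMA i:V. A `` {i}) = A" using A by auto
  then have "card A = card (SIGMA i:V. A `` {i})" by (rule arg_cong[OF sym])
  also have "\<dots> = (\<Sum>i\<in>V. card (A `` {i}))"
    using V finA by (intro card_SigmaI) auto
  finally have sum_out: "(\<Sum>i\<in>V. outd i) = int (card A)"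
    by (simp add: outd_def)
  have sum_in: "(\<Sum>i\<in>V. ind i) = int (card A)"
    unfolding sum_out[symmetric] in_r out_r by (rule sum.swap)
  \<comment> \<open>Double counting by the common out-neighbour \<open>k\<close>: each of
    \<open>i\<close> and \<open>j\<close> ranges over the in-neighbours of \<open>k\<close>.\<close>
  have "(\<Sum>i\<in>V. \<Sum>j\<in>V. p i j) = (\<Sum>i\<in>V. \<Sum>k\<in>V. \<Sum>j\<in>V. r i k * r j k)"
    unfolding p_r by (intro sum.cong refl sum.swap)
  also have "\<dots> = (\<Sum>k\<in>V. \<Sum>i\<in>V. \<Sum>j\<in>V. r i k * r j k)"
    by (rule sum.swap)
  also have "\<dots> = (\<Sum>k\<in>V. (ind k)\<^sup>2)"
    unfolding in_r power2_eq_square by (simp add: sum_product)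
  finally have sum_p: "(\<Sum>i\<in>V. \<Sum>j\<in>V. p i j) = (\<Sum>k\<in>V. (ind k)\<^sup>2)" .
  \<comment> \<open>The factor 4 combines \<open>p * (p - 1)\<close> as twice a binomial coefficient
    with the two orderings of each 2-set.\<close>
  have K: "(\<Sum>i\<in>V. \<Sum>j\<in>V - {i}. p i j * (p i j - 1)) = 4 * int (card (bicliques22 A))"
  proof -
    have "(\<Sum>i\<in>V. \<Sum>j\<in>V - {i}. p i j * (p i j - 1))
        = (\<Sum>i\<in>V. \<Sum>j\<in>V - {i}. 2 * int (card (\<Inter>u\<in>{i, j}. A `` {u}) choose 2))"
      by (simp add: p_def two_choose_2)
    also have "\<dots> = 2 * (\<Sum>U | U \<subseteq> V \<and> card U = 2. 2 * int (card (\<Inter>u\<in>U. A `` {u}) choose 2))"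
      by (rule sum_symmetric_pairs[OF V])
    also have "\<dots> = 4 * int (card (bicliques22 A))"
      unfolding card_bicliques22[OF V A] by (simp add: sum_distrib_left)
    finally show ?thesis .
  qed
  \<comment> \<open>Each square is written as \<open>p + p * (p - 1)\<close>; the second summand is
    split off at \<open>j = i\<close>, where the codegree is the outdegree.\<close>
  have split: "(\<Sum>j\<in>V. (p i j)\<^sup>2)
      = (outd i)\<^sup>2 - outd i + (\<Sum>j\<in>V. p i j) + (\<Sum>j\<in>V - {i}. p i j * (p i j - 1))"
    if "i \<in> V" for i
  proof -
    have "(\<Sum>j\<in>V. (p i j)\<^sup>2) = (\<Sum>j\<in>V. p i j) + (\<Sum>j\<in>V. p i j * (p i j - 1))"
      by (simp add: power2_eq_square algebra_simps flip: sum.distrib)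
    also have "(\<Sum>j\<in>V. p i j * (p i j - 1))
        = p i i * (p i i - 1) + (\<Sum>j\<in>V - {i}. p i j * (p i j - 1))"
      using V that by (rule sum.remove)
    finally show ?thesis by (simp add: pii power2_eq_square algebra_simps)
  qed
  have deg: "2 * int (d v choose 2) = (outd v)\<^sup>2 + (ind v)\<^sup>2 - outd v - ind v" for v
  proof -
    \<comment> \<open>Every vertex is a source or a sink, so the square of the degree has no mixed
      term.\<close>
    have "A `` {v} = {} \<or> A\<inverse> `` {v} = {}" using bip by auto
    then have "outd v = 0 \<or> ind v = 0" by (auto simp: outd_def ind_def)
    moreover have "int (d v) = outd v + ind v" by (simp add: d_def outd_def ind_def)
    ultimately show ?thesis unfolding two_choose_2 by (auto simp: power2_eq_square algebra_simps)
  qed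
  have "(\<Sum>i\<in>V. \<Sum>j\<in>V. (p i j)\<^sup>2)
      = (\<Sum>i\<in>V. (outd i)\<^sup>2) - int (card A) + (\<Sum>k\<in>V. (ind k)\<^sup>2) + 4 * int (card (bicliques22 A))"
    by (simp add: split sum.distrib sum_subtractf sum_out sum_p K)
  moreover have "2 * (\<Sum>v\<in>V. int (d v choose 2))
      = (\<Sum>i\<in>V. (outd i)\<^sup>2) + (\<Sum>k\<in>V. (ind k)\<^sup>2) - 2 * int (card A)"
    unfolding sum_distrib_left deg by (simp add: sum.distrib sum_subtractf sum_out sum_in)
  ultimately show ?thesis by (simp add: p_def)
qed

section \<open>Cycles of length 4 and full subquivers\<close>

lemma bipartite_quiver_tail_neq_head:
  assumes "bipartite_quiver Q" "a \<in> arcs Q" "b \<in> arcs Q"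
  shows "tail Q a \<noteq> head Q b"
proof -
  obtain V' V'' where "V' \<inter> V'' = {}" "\<forall>a\<in>arcs Q. tail Q a \<in> V' \<and> head Q a \<in> V''"
    using assms(1) unfolding bipartite_quiver_def by auto
  then have "tail Q a \<in> V'" "head Q b \<notin> V'" using assms(2,3) by auto
  then show ?thesis by auto
qed

lemma mem_arcs_endsI:
  assumes "a \<in> arcs Q" "tail Q a = u" "head Q a = w"
  shows "(u, w) \<in> arcs_ends Q"
  using assms by (auto simp: arcs_ends_conv)

lemma mem_arcs_endsE:
  assumes "(u, w) \<in> arcs_ends Q"
  obtains a where "a \<in> arcs Q" "tail Q a = u" "head Q a = w"
  using assms by (auto simp: arcs_ends_conv)

lemma arcs_ends_bipartite:
  assumes "bipartite_quiver Q"
  shows "Domain (arcs_ends Q) \<inter> Range (arcs_ends Q) = {}"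
  using bipartite_quiver_tail_neq_head[OF assms] by (force simp: arcs_ends_conv)

context nomulti_digraph
begin

abbreviation arcs_between :: "'a set \<times> 'a set \<Rightarrow> 'b set" where
  "arcs_between \<equiv> \<lambda>(U, W). {a \<in> arcs G. tail G a \<in> U \<and> head G a \<in> W}"

lemma arc_eqI:
  assumes "a \<in> arcs G" "b \<in> arcs G" "tail G a = tail G b" "head G a = head G b"
  shows "a = b"
  using assms no_multi_arcs by (auto simp: arc_to_ends_def)

lemma card_parallel_arcs:
  "card {a \<in> arcs G. tail G a = u \<and> head G a = w} = (if (u, w) \<in> arcs_ends G then 1 else 0)"
proof (cases "(u, w) \<in> arcs_ends G")
  case True
  then obtain a where "a \<in> arcs G" "tail G a = u" "head G a = w" by (auto simp: arcs_ends_conv)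
  then have "{a \<in> arcs G. tail G a = u \<and> head G a = w} = {a}" using arc_eqI by blast
  with True show ?thesis by simp
next
  case False
  then have none: "{a \<in> arcs G. tail G a = u \<and> head G a = w} = {}" by (auto intro: mem_arcs_endsI)
  show ?thesis unfolding none using False by simp
qed

lemma card_arcs_ends: "card (arcs_ends G) = card (arcs G)"
  unfolding arcs_ends_def by (rule card_image[OF inj_on_arc_to_ends])

text \<open>Without loops the correction summand is zero and the incident arcs split into outgoing
  and incoming ones. Without parallel arrows these correspond to out-neighbours and
  in-neighbours.\<close>

lemma underlying_degree_bipartite:
  assumes "bipartite_quiver G" "finite (arcs G)"
  shows "underlying_degree G v = card (arcs_ends G `` {v}) + card ((arcs_ends G)\<inverse> `` {v})"
proof -
  let ?O = "{a \<in> arcs G. tail G a = v}" and ?I = "{a \<in> arcs G. head G a = v}"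
  note bip = bipartite_quiver_tail_neq_head[OF assms(1)]
  have loops: "{a \<in> arcs G. edge_ends G a = {v}} = {}"
    using bip unfolding edge_ends_def by fastforce
  have "{a \<in> arcs G. v \<in> edge_ends G a} = ?O \<union> ?I"
    by (auto simp: edge_ends_def)
  moreover have "card (?O \<union> ?I) = card ?O + card ?I"
    using bip assms(2) by (intro card_Un_disjoint) (auto, metis)
  moreover have "arcs_ends G `` {v} = head G ` ?O" "(arcs_ends G)\<inverse> `` {v} = tail G ` ?I"
    by (auto simp: arcs_ends_conv)
  moreover have "inj_on (head G) ?O" "inj_on (tail G) ?I"
    by (auto intro!: inj_onI arc_eqI)
  ultimately show ?thesis
    unfolding underlying_degree_def loops by (simp add: card_image)
qed

section \<open>Bicliques and 4-cycles\<close>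

text \<open>Recovers a biclique from its arcs, which gives the injectivity of both correspondences
  below. Arcs to one fixed \<open>w\<^sub>0\<close> already reach back to all of \<open>U\<close>,
  and dually for \<open>W\<close>.\<close>

lemma arcs_between_biclique:
  assumes "(U, W) \<in> bicliques22 (arcs_ends G)"
  shows "tail G ` arcs_between (U, W) = U" "head G ` arcs_between (U, W) = W"
proof -
  have sub: "U \<times> W \<subseteq> arcs_ends G" and card: "card U = 2" "card W = 2"
    using assms by (auto simp: bicliques22_def)
  have arc: "\<exists>a\<in>arcs G. tail G a = u \<and> head G a = w" if "u \<in> U" "w \<in> W" for u w
    using sub that by (blast elim: mem_arcs_endsE)
  obtain u\<^sub>0 w\<^sub>0 where 0: "u\<^sub>0 \<in> U" "w\<^sub>0 \<in> W" using card by fastforce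
  show "tail G ` arcs_between (U, W) = U"
    using arc[OF _ 0(2)] 0(2) by auto
  show "head G ` arcs_between (U, W) = W"
    using arc[OF 0(1)] 0(1) by auto
qed

text \<open>The arcs are named in the order in which the 4-cycle through \<open>u\<close>,
  \<open>w\<close>, \<open>u'\<close>, \<open>w'\<close> uses them. That there are no others between
  the two sides is the absence of parallel arrows.\<close>

lemma square_biclique:
  assumes "a \<in> arcs G" "b \<in> arcs G" "c \<in> arcs G" "d \<in> arcs G"
    and "tail G a = u" "tail G d = u" "tail G b = u'" "tail G c = u'" "u \<noteq> u'"
    and "head G a = w" "head G b = w" "head G c = w'" "head G d = w'" "w \<noteq> w'"
  shows "({u, u'}, {w, w'}) \<in> bicliques22 (arcs_ends G)"
    and "arcs_between ({u, u'}, {w, w'}) = {a, b, c, d}"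
proof -
  have "(u, w) \<in> arcs_ends G" "(u, w') \<in> arcs_ends G" "(u', w) \<in> arcs_ends G" "(u', w') \<in> arcs_ends G"
    using assms by (blast intro: mem_arcs_endsI)+
  then show "({u, u'}, {w, w'}) \<in> bicliques22 (arcs_ends G)"
    using assms by (auto simp: bicliques22_def)
  show "arcs_between ({u, u'}, {w, w'}) = {a, b, c, d}"
    using assms by (auto intro: arc_eqI)
qed

text \<open>The facts on arcs and ends come in the order of the premises of
  \<open>square_biclique\<close>, so that they can be passed on as a block.\<close>

lemma bicliqueE:
  assumes "(U, W) \<in> bicliques22 (arcs_ends G)"
  obtains u u' w w' a b c d where
    "U = {u, u'}" "W = {w, w'}"
    "a \<in> arcs G" "b \<in> arcs G" "c \<in> arcs G" "d \<in> arcs G"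
    "tail G a = u" "tail G d = u" "tail G b = u'" "tail G c = u'" "u \<noteq> u'"
    "head G a = w" "head G b = w" "head G c = w'" "head G d = w'" "w \<noteq> w'"
proof -
  obtain u u' w w' where *: "U = {u, u'}" "u \<noteq> u'" "W = {w, w'}" "w \<noteq> w'"
    and sub: "U \<times> W \<subseteq> arcs_ends G"
    using assms by (auto simp: bicliques22_def card_2_iff)
  have "\<exists>a\<in>arcs G. tail G a = x \<and> head G a = y" if "x \<in> U" "y \<in> W" for x y
    using sub that by (blast elim: mem_arcs_endsE)
  from this[of u w] this[of u' w] this[of u' w'] this[of u w'] *(1,3)
  obtain a b c d where "a \<in> arcs G" "tail G a = u" "head G a = w"
    "b \<in> arcs G" "tail G b = u'" "head G b = w" "c \<in> arcs G" "tail G c = u'" "head G c = w'"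
    "d \<in> arcs G" "tail G d = u" "head G d = w'"
    by auto
  with * show ?thesis by (intro that[of u u' w w' a b c d]) simp_all
qed

text \<open>The inverse sends an edge set to its tails and heads. For surjectivity, the vertices of
  a 4-cycle alternate between tails and heads, so the direction of one edge determines the other
  three.\<close>

lemma bij_betw_bicliques_cycles:
  assumes bip: "bipartite_quiver G"
  shows "bij_betw arcs_between (bicliques22 (arcs_ends G)) (underlying_cycles G 4)"
proof (rule bij_betw_imageI)
  note neq = bipartite_quiver_tail_neq_head[OF bip]
  show "inj_on arcs_between (bicliques22 (arcs_ends G))"
  proof (rule inj_on_inverseI[where g = "\<lambda>F. (tail G ` F, head G ` F)"])
    fix X assume "X \<in> bicliques22 (arcs_ends G)"
    then show "(tail G ` arcs_between X, head G ` arcs_between X) = X"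
      using arcs_between_biclique[of "fst X" "snd X"] by (simp add: split_def)
  qed
  show "arcs_between ` bicliques22 (arcs_ends G) = underlying_cycles G 4"
  proof (intro equalityI subsetI)
    fix F assume "F \<in> arcs_between ` bicliques22 (arcs_ends G)"
    then obtain U W where UW: "(U, W) \<in> bicliques22 (arcs_ends G)" and F: "F = arcs_between (U, W)"
      by auto
    from UW show "F \<in> underlying_cycles G 4"
    proof (cases rule: bicliqueE)
      case (1 u u' w w' a b c d)
      have set: "F = set [a, b, c, d]"
        unfolding F 1(1,2) square_biclique(2)[OF 1(3-)] by simp
      have ne: "u \<noteq> w" "u \<noteq> w'" "u' \<noteq> w" "u' \<noteq> w'"
        using neq[OF 1(3,3)] neq[OF 1(3,5)] neq[OF 1(4,3)] neq[OF 1(4,5)] 1(7-15) by simp_all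
      have "distinct [a, b, c, d]" "distinct [u, w, u', w']"
        using 1(7-16) ne by auto
      moreover have "\<forall>i<4. edge_ends G ([a, b, c, d] ! i) = {[u, w, u', w'] ! i, [u, w, u', w'] ! (Suc i mod 4)}"
      proof (intro allI impI)
        fix i :: nat assume "i < 4"
        then consider "i = 0" | "i = 1" | "i = 2" | "i = 3" by linarith
        then show "edge_ends G ([a, b, c, d] ! i) = {[u, w, u', w'] ! i, [u, w, u', w'] ! (Suc i mod 4)}"
          using 1(7-16) by cases (simp_all add: edge_ends_def insert_commute)
      qed
      ultimately show ?thesis
        unfolding underlying_cycles_def mem_Collect_eq using set 1
        by (intro exI[of _ "[a, b, c, d]"] exI[of _ "[u, w, u', w']"]) auto
    qed
  next
    fix F assume "F \<in> underlying_cycles G 4"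
    then obtain es vs where F: "F = set es" and len: "length es = 4" "length vs = 4"
      and dist: "distinct es" "distinct vs" and sub: "set es \<subseteq> arcs G"
      and ends: "\<forall>i<4. edge_ends G (es ! i) = {vs ! i, vs ! (Suc i mod 4)}"
      unfolding underlying_cycles_def by blast
    obtain a b c d where es: "es = [a, b, c, d]"
      using len(1) by (auto simp: length_Suc_conv numeral_eq_Suc)
    obtain v0 v1 v2 v3 where vs: "vs = [v0, v1, v2, v3]"
      using len(2) by (auto simp: length_Suc_conv numeral_eq_Suc)
    have arcs: "a \<in> arcs G" "b \<in> arcs G" "c \<in> arcs G" "d \<in> arcs G" using sub es by auto
    have v: "v0 \<noteq> v2" "v1 \<noteq> v3" using dist vs by auto
    have e: "{tail G a, head G a} = {v0, v1}" "{tail G b, head G b} = {v1, v2}"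
      "{tail G c, head G c} = {v2, v3}" "{tail G d, head G d} = {v3, v0}"
      using ends[rule_format, of 0] ends[rule_format, of 1] ends[rule_format, of 2]
        ends[rule_format, of 3] unfolding es vs edge_ends_def by auto
    \<comment> \<open>Either the even or the odd positions of the cycle are the tails.\<close>
    from e(1) consider "tail G a = v0" "head G a = v1" | "tail G a = v1" "head G a = v0"
      by (auto simp: doubleton_eq_iff)
    then show "F \<in> arcs_between ` bicliques22 (arcs_ends G)"
    proof cases
      case 1
      have b: "tail G b = v2" "head G b = v1"
        using e(2) 1 neq[OF arcs(2,1)] by (auto simp: doubleton_eq_iff)
      have c: "tail G c = v2" "head G c = v3"
        using e(3) b neq[OF arcs(2,3)] by (auto simp: doubleton_eq_iff)
      have d: "tail G d = v0" "head G d = v3"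
        using e(4) 1 neq[OF arcs(1,4)] by (auto simp: doubleton_eq_iff)
      note * = square_biclique[OF arcs 1(1) d(1) b(1) c(1) v(1) 1(2) b(2) c(2) d(2) v(2)]
      have "F = arcs_between ({v0, v2}, {v1, v3})" unfolding *(2) F es by simp
      with *(1) show ?thesis by blast
    next
      case 2
      have b: "tail G b = v1" "head G b = v2"
        using e(2) 2 neq[OF arcs(1,2)] by (auto simp: doubleton_eq_iff)
      have c: "tail G c = v3" "head G c = v2"
        using e(3) b neq[OF arcs(3,2)] by (auto simp: doubleton_eq_iff)
      have d: "tail G d = v3" "head G d = v0"
        using e(4) 2 neq[OF arcs(4,1)] by (auto simp: doubleton_eq_iff)
      \<comment> \<open>The cycle is rotated by one edge so that it again begins at a tail, now
        \<open>v1\<close>.\<close>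
      note * = square_biclique[OF arcs(2,3,4,1) b(1) 2(1) c(1) d(1) v(2) b(2) c(2) d(2) 2(2) v(1)[symmetric]]
      have "F = arcs_between ({v1, v3}, {v2, v0})" unfolding *(2) F es by auto
      with *(1) show ?thesis by blast
    qed
  qed
qed

section \<open>Bicliques and full subquivers\<close>

text \<open>Vertices of \<open>U\<close> are tails and those of \<open>W\<close> are heads, so by
  bipartiteness an arc inside the union can only run from \<open>U\<close> to
  \<open>W\<close>.\<close>

lemma arcs_induce_biclique:
  assumes bip: "bipartite_quiver G" and UW: "(U, W) \<in> bicliques22 (arcs_ends G)"
  shows "arcs (G \<restriction> (U \<union> W)) = arcs_between (U, W)"
proof -
  note neq = bipartite_quiver_tail_neq_head[OF bip]
  have "tail G a \<notin> W" "head G a \<notin> U" if a: "a \<in> arcs G" for a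
  proof -
    have "tail G a \<notin> head G ` arcs_between (U, W)" using neq[OF a] by auto
    then show "tail G a \<notin> W" unfolding arcs_between_biclique(2)[OF UW] .
    have "head G a \<notin> tail G ` arcs_between (U, W)" using neq[OF _ a] by fastforce
    then show "head G a \<notin> U" unfolding arcs_between_biclique(1)[OF UW] .
  qed
  then show ?thesis by auto
qed

lemma biclique_iso_A22:
  assumes bip: "bipartite_quiver G" and UW: "(U, W) \<in> bicliques22 (arcs_ends G)"
  shows "G \<restriction> (U \<union> W) \<in> full_A22_subquivers G"
  using UW
proof (cases rule: bicliqueE)
  case (1 u u' w w' a b c d)
  note neq = bipartite_quiver_tail_neq_head[OF bip]
  let ?H = "G \<restriction> (U \<union> W)"
  have arcs_H: "arcs ?H = {a, b, c, d}"
    unfolding arcs_induce_biclique[OF assms] unfolding 1(1,2) by (rule square_biclique[OF 1(3-)])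
  have ne: "u \<noteq> w" "u \<noteq> w'" "u' \<noteq> w" "u' \<noteq> w'"
    using neq[OF 1(3,3)] neq[OF 1(3,5)] neq[OF 1(4,3)] neq[OF 1(4,5)] 1(7-15) by simp_all
  have "U \<union> W \<subseteq> verts G" using 1 by auto
  then have ind: "induced_subgraph ?H G" by (rule induced_induce)
  then have wf: "wf_digraph ?H" by (simp add: induced_subgraph_def subgraph_def)
  \<comment> \<open>The default value \<open>Inr 2\<close> is the image intended for
    \<open>w'\<close>; only the values on \<open>U \<union> W\<close> matter.\<close>
  define f :: "'a \<Rightarrow> nat + nat" where
    "f v = (if v = u then Inl 1 else if v = u' then Inl 2 else if v = w then Inr 1 else Inr 2)" for v
  have f: "f u = Inl 1" "f u' = Inl 2" "f w = Inr 1" "f w' = Inr 2"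
    using 1 ne by (auto simp: f_def)
  \<comment> \<open>Arcs of \<open>A22_tilde\<close> are pairs of vertices, so an arc is sent to the
    pair of images of its ends. This makes the image equal to \<open>A22_tilde\<close> as a
    record.\<close>
  define hom where "hom = \<lparr>iso_verts = f, iso_arcs = \<lambda>a. (f (tail G a), f (head G a)),
    iso_head = snd, iso_tail = fst\<rparr>"
  have "pre_digraph.digraph_isomorphism ?H hom"
    unfolding pre_digraph.digraph_isomorphism_def arcs_H using wf f 1
    by (auto simp: hom_def inj_on_def)
  moreover have "A22_tilde = app_iso hom ?H"
  proof (rule pre_digraph.equality)
    show "verts A22_tilde = verts (app_iso hom ?H)"
      unfolding 1(1,2) using f by (auto simp: A22_tilde_def hom_def)
    show "arcs A22_tilde = arcs (app_iso hom ?H)"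
      unfolding arcs_app_iso arcs_H using f 1 by (auto simp: A22_tilde_def hom_def)
  qed (simp_all add: A22_tilde_def hom_def app_iso_def)
  ultimately have "digraph_iso ?H A22_tilde" unfolding digraph_iso_def by blast
  with ind show ?thesis unfolding full_A22_subquivers_def by blast
qed

text \<open>\<open>U\<close> and \<open>W\<close> are the preimages of the \<open>Inl\<close> and
  the \<open>Inr\<close> vertices under the isomorphism, and an induced subgraph is determined by
  its vertex set.\<close>

lemma full_A22_biclique:
  assumes "H \<in> full_A22_subquivers G"
  obtains U W where "(U, W) \<in> bicliques22 (arcs_ends G)" "H = G \<restriction> (U \<union> W)"
proof -
  have ind: "induced_subgraph H G" and "digraph_iso H A22_tilde"
    using assms by (auto simp: full_A22_subquivers_def)
  then obtain hom where hom: "pre_digraph.digraph_isomorphism H hom" and A22: "A22_tilde = app_iso hom H"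
    unfolding digraph_iso_def by blast
  let ?f = "iso_verts hom"
  have sub: "subgraph H G" using ind by (simp add: induced_subgraph_def)
  then have th: "tail H = tail G" "head H = head G"
    by (simp_all add: subgraph_def compatible_def)
  interpret H: wf_digraph H using sub by (simp add: subgraph_def)
  have inj: "inj_on ?f (verts H)" using hom by (simp add: H.digraph_isomorphism_def)
  have verts: "?f ` verts H = Inl ` {1, 2} \<union> Inr ` {1, 2}"
    using arg_cong[OF A22, of verts] by (simp add: A22_tilde_def Plus_def)
  have arcs: "iso_arcs hom ` arcs H = {(Inl i, Inr j) | i j. i \<in> {1, 2} \<and> j \<in> {1, 2}}"
    using arg_cong[OF A22, of arcs] by (simp add: A22_tilde_def)
  have tl: "iso_tail hom = fst" "iso_head hom = snd"
    using arg_cong[OF A22, of tail] arg_cong[OF A22, of head] by (simp_all add: A22_tilde_def)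
  define U where "U = {v \<in> verts H. ?f v \<in> Inl ` {1, 2}}"
  define W where "W = {v \<in> verts H. ?f v \<in> Inr ` {1, 2}}"
  have UW: "verts H = U \<union> W" using verts unfolding U_def W_def by blast
  have fibre: "?f ` {v \<in> verts H. ?f v \<in> S} = S" if "S \<subseteq> ?f ` verts H" for S
    using that by auto
  have "?f ` U = Inl ` {1, 2}" "?f ` W = Inr ` {1, 2}"
    unfolding U_def W_def by (rule fibre, simp add: verts)+
  moreover have "inj_on ?f U" "inj_on ?f W"
    using inj UW by (auto intro: inj_on_subset)
  ultimately have "card U = card (Inl ` {1, 2} :: (nat + nat) set)"
    "card W = card (Inr ` {1, 2} :: (nat + nat) set)"
    by (metis card_image)+
  then have card: "card U = 2" "card W = 2" by (simp_all add: card_image)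
  have "(u, w) \<in> arcs_ends G" if uw: "u \<in> U" "w \<in> W" for u w
  proof -
    \<comment> \<open>The arc of \<open>A22_tilde\<close> is pulled back to \<open>H\<close>;
      injectivity on vertices identifies the ends of its preimage with \<open>u\<close> and
      \<open>w\<close>.\<close>
    have "(?f u, ?f w) \<in> iso_arcs hom ` arcs H"
      unfolding arcs using uw by (auto simp: U_def W_def)
    then obtain a where a: "a \<in> arcs H" "iso_arcs hom a = (?f u, ?f w)" by auto
    then have f: "?f (tail H a) = ?f u" "?f (head H a) = ?f w"
      using hom tl by (simp_all add: H.digraph_isomorphism_def)
    have "u \<in> verts H" "w \<in> verts H" using uw UW by simp_all
    then have "tail H a = u" "head H a = w"
      using inj_onD[OF inj f(1)] inj_onD[OF inj f(2)] a(1) by simp_all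
    moreover have "a \<in> arcs G" using a(1) sub by (auto simp: subgraph_def)
    ultimately show ?thesis using mem_arcs_endsI th by metis
  qed
  then have "(U, W) \<in> bicliques22 (arcs_ends G)"
    using card by (auto simp: bicliques22_def)
  moreover have "H = G \<restriction> (U \<union> W)"
    using ind UW th by (intro pre_digraph.equality) (auto simp: induced_subgraph_def)
  ultimately show ?thesis by (rule that)
qed

lemma bij_betw_bicliques_full_A22:
  assumes bip: "bipartite_quiver G"
  shows "bij_betw (\<lambda>(U, W). G \<restriction> (U \<union> W)) (bicliques22 (arcs_ends G)) (full_A22_subquivers G)"
proof (rule bij_betw_imageI)
  show "inj_on (\<lambda>(U, W). G \<restriction> (U \<union> W)) (bicliques22 (arcs_ends G))"
  proof (rule inj_on_inverseI[where g = "\<lambda>H. (tail G ` arcs H, head G ` arcs H)"])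
    fix X assume X: "X \<in> bicliques22 (arcs_ends G)"
    obtain U W where UW: "X = (U, W)" by (cases X)
    show "(tail G ` arcs ((\<lambda>(U, W). G \<restriction> (U \<union> W)) X), head G ` arcs ((\<lambda>(U, W). G \<restriction> (U \<union> W)) X)) = X"
      unfolding UW prod.case arcs_induce_biclique[OF bip X[unfolded UW], unfolded prod.case]
        arcs_between_biclique[OF X[unfolded UW], unfolded prod.case]
      by (rule refl)
  qed
  show "(\<lambda>(U, W). G \<restriction> (U \<union> W)) ` bicliques22 (arcs_ends G) = full_A22_subquivers G"
  proof (intro equalityI subsetI)
    fix H assume "H \<in> full_A22_subquivers G"
    then obtain U W where "(U, W) \<in> bicliques22 (arcs_ends G)" "H = G \<restriction> (U \<union> W)"
      by (rule full_A22_biclique)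
    then show "H \<in> (\<lambda>(U, W). G \<restriction> (U \<union> W)) ` bicliques22 (arcs_ends G)"
      by (intro image_eqI[of _ _ "(U, W)"]) simp_all
  qed (auto intro: biclique_iso_A22[OF bip])
qed

end

section \<open>Assembling the coefficients\<close>

lemma sum_indicator_eq_card:
  assumes "finite V" "S \<subseteq> V"
  shows "(\<Sum>x\<in>V. if x \<in> S then 1 else 0) = int (card S)"
  using assms by (simp add: sum.If_cases Int_absorb1)

theorem theorem1p1:
  fixes n :: nat and Q :: "(nat, 'b) pre_digraph"
  assumes "n \<ge> 2"
    and "fin_digraph Q" and "nomulti_digraph Q"
    and "verts Q = {1..n}"
    and "bipartite_quiver Q"
  defines "e \<equiv> card (arcs Q)"
    and "d \<equiv> underlying_degree Q"
    and "q \<equiv> card (underlying_cycles Q 4)"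
  shows "degree (coxeter_poly n Q) = n \<and> coeff (coxeter_poly n Q) n = 1 \<and>
    coeff (coxeter_poly n Q) (n - 1) = int n - int e \<and>
    (of_int (coeff (coxeter_poly n Q) (n - 2)) :: rat) =
      (of_nat n - of_nat e) * (of_nat n - 1 - of_nat e) / 2 + of_nat e - 2 * of_nat q
        - (\<Sum>i = 1..n. of_nat (d i choose 2)) \<and>
    q = card (full_A22_subquivers Q)"
proof -
  interpret fin_digraph Q by (rule assms(2))
  interpret nomulti_digraph Q by (rule assms(3))
  note bip = assms(5)
  let ?A = "arcs_ends Q" and ?V = "{1..n}"
  define N where "N = adjacency_mat n Q"
  define B where "B = (1\<^sub>m n + N) * (transpose_mat N - 1\<^sub>m n)"
  define S where "S = (\<Sum>i = 1..n. int (d i choose 2))"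
  have A: "?A \<subseteq> ?V \<times> ?V"
    unfolding arcs_ends_conv using wellformed assms(4) by auto
  have N: "N \<in> carrier_mat n n" by (simp add: N_def adjacency_mat_def)
  have B: "B \<in> carrier_mat n n" unfolding B_def using N by auto
  have entry: "N $$ (i, j) = (if (Suc i, Suc j) \<in> ?A then 1 else 0)" if "i < n" "j < n" for i j
    using that by (simp add: N_def adjacency_mat_def card_parallel_arcs)
  \<comment> \<open>Passes from matrix indices, which start at 0, to the vertices
    \<open>1..n\<close>.\<close>
  have shift: "(\<Sum>i<n. f (Suc i)) = (\<Sum>v\<in>?V. f v)" for f :: "nat \<Rightarrow> int"
    by (simp add: sum.atLeast1_atMost_eq)
  have N_bip: "N $$ (i, j) = 0 \<or> N $$ (j, k) = 0" if "i < n" "j < n" "k < n" for i j k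
    using arcs_ends_bipartite[OF bip] that by (auto simp: entry)
  have N01: "N $$ (i, j) \<in> {0, 1}" if "i < n" "j < n" for i j
    using that by (simp add: entry)

  have "(\<Sum>i<n. \<Sum>j<n. N $$ (i, j)) = (\<Sum>i<n. \<Sum>j<n. if (Suc i, Suc j) \<in> ?A then 1 else 0)"
    by (simp add: entry)
  also have "\<dots> = (\<Sum>u\<in>?V. \<Sum>w\<in>?V. if (u, w) \<in> ?A then 1 else 0)"
    \<comment> \<open>The first instance reindexes the inner sum for an arbitrary row, the second
      the outer sum.\<close>
    by (simp only: shift[of "\<lambda>w. if (_, w) \<in> ?A then 1 else 0"]
        shift[of "\<lambda>u. \<Sum>w\<in>?V. if (u, w) \<in> ?A then 1 else 0"])
  also have "\<dots> = (\<Sum>x\<in>?V \<times> ?V. if x \<in> ?A then 1 else 0)"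
    by (simp add: sum.cartesian_product split_def)
  also have "\<dots> = int e"
    unfolding e_def card_arcs_ends[symmetric] using A by (intro sum_indicator_eq_card) auto
  finally have e_sum: "(\<Sum>i<n. \<Sum>j<n. N $$ (i, j)) = int e" .

  \<comment> \<open>The product of two 0-1 entries is the indicator of a common
    out-neighbour.\<close>
  have codeg: "(\<Sum>k<n. N $$ (i, k) * N $$ (j, k)) = int (card (?A `` {Suc i} \<inter> ?A `` {Suc j}))"
    if "i < n" "j < n" for i j
  proof -
    have "(\<Sum>k<n. N $$ (i, k) * N $$ (j, k))
        = (\<Sum>k<n. if Suc k \<in> ?A `` {Suc i} \<inter> ?A `` {Suc j} then 1 else 0)"
      using that by (intro sum.cong) (auto simp: entry)
    also have "\<dots> = (\<Sum>v\<in>?V. if v \<in> ?A `` {Suc i} \<inter> ?A `` {Suc j} then 1 else 0)"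
      by (rule shift)
    also have "\<dots> = int (card (?A `` {Suc i} \<inter> ?A `` {Suc j}))"
      using A by (intro sum_indicator_eq_card) auto
    finally show ?thesis .
  qed
  have "(\<Sum>i<n. \<Sum>j<n. (\<Sum>k<n. N $$ (i, k) * N $$ (j, k))\<^sup>2)
      = (\<Sum>i<n. \<Sum>j<n. (int (card (?A `` {Suc i} \<inter> ?A `` {Suc j})))\<^sup>2)"
    by (intro sum.cong refl) (simp add: codeg)
  also have "\<dots> = (\<Sum>u\<in>?V. \<Sum>w\<in>?V. (int (card (?A `` {u} \<inter> ?A `` {w})))\<^sup>2)"
    by (simp only: shift[of "\<lambda>w. (int (card (?A `` {_} \<inter> ?A `` {w})))\<^sup>2"]
        shift[of "\<lambda>u. \<Sum>w\<in>?V. (int (card (?A `` {u} \<inter> ?A `` {w})))\<^sup>2"])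
  also have "\<dots> = int e + 4 * int q + 2 * S"
    unfolding S_def e_def d_def q_def card_arcs_ends[symmetric]
      underlying_degree_bipartite[OF bip finite_arcs]
      bij_betw_same_card[OF bij_betw_bicliques_cycles[OF bip], symmetric]
    using A arcs_ends_bipartite[OF bip] by (intro sum_codegree_squares) auto
  finally have walks: "(\<Sum>i<n. \<Sum>j<n. (\<Sum>k<n. N $$ (i, k) * N $$ (j, k))\<^sup>2)
      = int e + 4 * int q + 2 * S" .

  have poly: "coxeter_poly n Q = char_poly B"
    unfolding coxeter_poly_def cartan_mat_def N_def[symmetric] B_def
    using N N_bip by (rule det_coxeter_eq_char_poly)
  have tr: "trace_mat B = int e - int n"
    using trace_coxeter_01(1)[OF N N_bip N01] e_sum by (simp add: B_def)
  have tr2: "trace_mat (B * B) = int n - 3 * int e + 4 * int q + 2 * S"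
    using trace_coxeter_01(2)[OF N N_bip N01] e_sum walks by (simp add: B_def)
  \<comment> \<open>The identity is kept doubled over the integers; division by 2 takes place only
    after the passage to the rationals.\<close>
  have "2 * coeff (coxeter_poly n Q) (n - 2)
      = (int n - int e) * (int n - 1 - int e) + 2 * int e - 4 * int q - 2 * S"
    unfolding poly char_poly_coeffs_int(2)[OF B assms(1)] tr tr2
    by (simp add: power2_eq_square algebra_simps)
  then have "(of_int (2 * coeff (coxeter_poly n Q) (n - 2)) :: rat) =
      of_int ((int n - int e) * (int n - 1 - int e) + 2 * int e - 4 * int q - 2 * S)"
    by (rule arg_cong)
  then have "(of_int (coeff (coxeter_poly n Q) (n - 2)) :: rat) =
      (of_nat n - of_nat e) * (of_nat n - 1 - of_nat e) / 2 + of_nat e - 2 * of_nat q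
        - (\<Sum>i = 1..n. of_nat (d i choose 2))"
    by (simp add: S_def)
  moreover have "coeff (coxeter_poly n Q) (n - 1) = int n - int e"
    unfolding poly char_poly_coeffs_int(1)[OF B assms(1)] tr by simp
  moreover have "degree (coxeter_poly n Q) = n" "coeff (coxeter_poly n Q) n = 1"
    unfolding poly using degree_monic_char_poly[OF B] by simp_all
  moreover have "q = card (full_A22_subquivers Q)"
    unfolding q_def using bij_betw_same_card[OF bij_betw_bicliques_cycles[OF bip]]
      bij_betw_same_card[OF bij_betw_bicliques_full_A22[OF bip]] by simp
  ultimately show ?thesis by blast
qed

end
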